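(* Let $A\in\mathbb{R}^{N\times N}$, $C\in\mathbb{R}^{M\times N}$, let $Q\in\mathbb{R}^{N\times N}$ be symmetric positive semidefinite and $R\in\mathbb{R}^{M\times M}$ symmetric positive definite. Assume that $(A,Q^{1/2})$ is controllable and $(C,A)$ is observable. Then $\overline{\gamma}^{\mathrm{sb}}=0$; that is, for every $\overline{\gamma}\in(0,1]$ and every initial state $P_0\in\mathbb{S}_+^N$ the random Riccati sequence $\{P_t\}_{t\ge 0}$ is stochastically bounded: $$\lim_{K\to\infty}\ \sup_{t\ge 0}\ \mathbb{P}^{\overline{\gamma},P_0}\left(\|P_t\|>K\right)=0 .$$
   Context: $\mathbb{S}_+^N$ is the set of real symmetric positive semidefinite $N\times N$ matrices, with the spectral norm $\|\cdot\|$. Define $f_0,f_1:\mathbb{S}_+^N\to\mathbb{S}_+^N$ by $f_0(X)=AXA^T+Q$ and $f_1(X)=AXA^T+Q-AXC^T(CXC^T+R)^{-1}CXA^T$. For $\overline{\gamma}\in[0,1]$, let $\{\gamma_t\}_{t\ge0}$ be i.i.d. Bernoulli with $\mathbb{P}(\gamma_t=1)=\overline{\gamma}$; given a deterministic $P_0\in\mathbb{S}_+^N$, the random Riccati sequence is $P_{t+1}=f_{\gamma_t}(P_t)$. $\mathbb{P}^{\overline{\gamma},P_0}$ denotes probability for arrival probability $\overline{\gamma}$ and initial state $P_0$. $\overline{\gamma}^{\mathrm{sb}}$ is the infimum of all $\overline{\gamma}\in[0,1]$ for which $\{P_t\}$ is stochastically bounded from every initial state $P_0\in\mathbb{S}_+^N$.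 *)

theory Defs
  imports "HOL-Probability.Probability"
begin

definition psd_mats :: "(real^'n^'n) set" where
  "psd_mats = {X. transpose X = X \<and> (\<forall>x. x \<bullet> (X *v x) \<ge> 0)}"

definition pd_mats :: "(real^'n^'n) set" where
  "pd_mats = {X. transpose X = X \<and> (\<forall>x. x \<noteq> 0 \<longrightarrow> x \<bullet> (X *v x) > 0)}"

text \<open>Only meaningful on \<^term>\<open>psd_mats\<close>, where the positive semidefinite square root exists
  and is unique.\<close>
definition psd_sqrt :: "real^'n^'n \<Rightarrow> real^'n^'n" where
  "psd_sqrt X = (THE S. S \<in> psd_mats \<and> S ** S = X)"

definition spectral_norm :: "real^'n^'m \<Rightarrow> real" where
  "spectral_norm X = onorm ((*v) X)"

text \<open>Kalman's rank conditions: the block matrix $[B, AB, \ldots, A^{N-1}B]$ has rank $N$, and so has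
  the one that stacks $C, CA, \ldots, CA^{N-1}$. Rank is the dimension of the set of all columns
  (rows) of the blocks, as in \<open>column_rank_def\<close> and \<open>row_rank_def\<close>. The matrix powers are
  iterated \<open>**\<close>, since \<open>^\<close> on type \<open>vec\<close> is componentwise.\<close>
definition controllable :: "real^'n^'n \<Rightarrow> real^'m^'n \<Rightarrow> bool" where
  "controllable A B \<longleftrightarrow>
     dim (\<Union>k<CARD('n). columns (((\<lambda>X. A ** X) ^^ k) B)) = CARD('n)"

definition observable :: "real^'n^'m \<Rightarrow> real^'n^'n \<Rightarrow> bool" where
  "observable C A \<longleftrightarrow>
     dim (\<Union>k<CARD('n). rows (((\<lambda>X. X ** A) ^^ k) C)) = CARD('n)"

definition riccati0 :: "real^'n^'n \<Rightarrow> real^'n^'n \<Rightarrow> real^'n^'n \<Rightarrow> real^'n^'n" where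
  "riccati0 A Q X = A ** X ** transpose A + Q"

definition riccati1 ::
  "real^'n^'n \<Rightarrow> real^'n^'m \<Rightarrow> real^'n^'n \<Rightarrow> real^'m^'m \<Rightarrow> real^'n^'n \<Rightarrow> real^'n^'n" where
  "riccati1 A C Q R X =
     A ** X ** transpose A + Q
     - A ** X ** transpose C ** matrix_inv (C ** X ** transpose C + R) ** C ** X ** transpose A"

text \<open>The arrival sequence \<open>\<gamma>\<close> is boolean-valued, \<open>True\<close> standing for 1.\<close>
primrec riccati_seq ::
  "real^'n^'n \<Rightarrow> real^'n^'m \<Rightarrow> real^'n^'n \<Rightarrow> real^'m^'m \<Rightarrow> real^'n^'n
     \<Rightarrow> (nat \<Rightarrow> bool) \<Rightarrow> nat \<Rightarrow> real^'n^'n" where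
  "riccati_seq A C Q R P0 \<gamma> 0 = P0"
| "riccati_seq A C Q R P0 \<gamma> (Suc t) =
     (if \<gamma> t then riccati1 A C Q R (riccati_seq A C Q R P0 \<gamma> t)
      else riccati0 A Q (riccati_seq A C Q R P0 \<gamma> t))"

text \<open>The law of an i.i.d. Bernoulli sequence; the arrivals are the coordinates. By
  \<open>riccati_prob_unique\<close> below, the choice of this sample space is immaterial.\<close>
definition arrivals :: "real \<Rightarrow> (nat \<Rightarrow> bool) measure" where
  "arrivals p = (\<Pi>\<^sub>M t\<in>UNIV. measure_pmf (bernoulli_pmf p))"

definition stochastically_bounded ::
  "'w measure \<Rightarrow> (nat \<Rightarrow> 'w \<Rightarrow> real^'n^'n) \<Rightarrow> bool" where
  "stochastically_bounded W P \<longleftrightarrow>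
     ((\<lambda>K. SUP t. measure W {w \<in> space W. spectral_norm (P t w) > K}) \<longlongrightarrow> 0) at_top"

definition gamma_sb ::
  "real^'n^'n \<Rightarrow> real^'n^'m \<Rightarrow> real^'n^'n \<Rightarrow> real^'m^'m \<Rightarrow> real" where
  "gamma_sb A C Q R =
     Inf {p \<in> {0..1}. \<forall>P0 \<in> psd_mats.
            stochastically_bounded (arrivals p) (\<lambda>t \<gamma>. riccati_seq A C Q R P0 \<gamma> t)}"

lemma space_arrivals: "space (arrivals p) = UNIV"
  by (simp add: arrivals_def space_PiM PiE_UNIV_domain)

lemma sets_arrivals: "sets (arrivals p) = sets (\<Pi>\<^sub>M t\<in>UNIV. count_space UNIV)"
  unfolding arrivals_def by (intro sets_PiM_cong) auto

lemma riccati_seq_measurable: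
  "(\<lambda>\<gamma>. riccati_seq A C Q R P0 \<gamma> t) \<in> measurable (arrivals p) (count_space UNIV)"
proof (induction t)
  case 0
  then show ?case by simp
next
  case (Suc t)
  have c: "(\<lambda>\<gamma>. \<gamma> t) \<in> measurable (arrivals p) (count_space UNIV)"
    unfolding measurable_cong_sets[OF sets_arrivals refl]
    by (rule measurable_component_singleton) simp
  have "(\<lambda>\<gamma>. F (riccati_seq A C Q R P0 \<gamma> t)) \<in> measurable (arrivals p) (count_space UNIV)"
    for F :: "real^'a^'a \<Rightarrow> real^'a^'a"
    by (rule measurable_compose[OF Suc]) simp
  from measurable_If[OF this this, of "\<lambda>\<gamma>. \<gamma> t"] c show ?case
    by (simp add: pred_def)
qed

lemma riccati_prob_unique:
  fixes W :: "'w measure" and \<gamma> :: "nat \<Rightarrow> 'w \<Rightarrow> bool"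
  assumes "prob_space W"
    and indep: "prob_space.indep_vars W (\<lambda>_. count_space UNIV) \<gamma> UNIV"
    and bern: "\<And>t. distr W (count_space UNIV) (\<gamma> t) = measure_pmf (bernoulli_pmf p)"
  shows "measure W {w \<in> space W. spectral_norm (riccati_seq A C Q R P0 (\<lambda>t. \<gamma> t w) t) > K}
       = measure (arrivals p) {\<gamma>. spectral_norm (riccati_seq A C Q R P0 \<gamma> t) > K}"
    (is "_ = measure _ ?S")
proof -
  interpret prob_space W by fact
  have rv: "random_variable (count_space UNIV) (\<gamma> t)" for t
    using indep by (auto simp: indep_vars_def)
  have d: "distr W (\<Pi>\<^sub>M i\<in>UNIV. count_space UNIV) (\<lambda>w t. \<gamma> t w) = arrivals p"
    using indep_vars_iff_distr_eq_PiM[where I = UNIV and M' = "\<lambda>_. count_space UNIV" and X = \<gamma>] rv indep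
    by (simp add: bern arrivals_def restrict_UNIV)
  have m: "(\<lambda>w t. \<gamma> t w) \<in> measurable W (\<Pi>\<^sub>M i\<in>UNIV. count_space UNIV)"
    using rv measurable_restrict[of UNIV \<gamma> W "\<lambda>_. count_space UNIV"]
    by (simp add: restrict_UNIV)
  have "?S \<in> sets (arrivals p)"
    using measurable_sets[OF riccati_seq_measurable, of "{X. spectral_norm X > K}"]
    by (simp add: space_arrivals vimage_def)
  then show ?thesis
    unfolding d[symmetric] using m
    by (subst measure_distr) (auto simp: vimage_def intro!: arg_cong[where f = "measure W"])
qed

end

theory Submission
  imports Defs
begin

text \<open>
  Completing the square gives, for every \<open>u\<close>, the bound
  \<open>x \<bullet> f\<^sub>1(X) x \<le> z \<bullet> X z + x \<bullet> Q x + u \<bullet> R u\<close> with \<open>z = A\<^sup>T x - C\<^sup>T u\<close>.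
  Iterating it \<open>N\<close> times turns \<open>x\<close> into the state of the dual system \<open>(A\<^sup>T, C\<^sup>T)\<close>,
  which observability of \<open>(C, A)\<close> allows one to steer to \<open>0\<close> in \<open>N\<close> steps; hence
  \<open>N\<close> consecutive arrivals bring the norm below a constant that does not depend on the
  current state. Each step increases the norm by at most a fixed affine map, so \<open>P\<^sub>t\<close> can only
  be large if none of the last \<open>L\<close> blocks of length \<open>N\<close> consists of arrivals alone, which has
  probability \<open>(1 - p\<^sup>N)\<^sup>L\<close>.
\<close>

section \<open>Symmetric quadratic forms and matrix inverses\<close>

lemma symmetric_bilinear_commute:
  fixes X :: "real^'n^'n"
  assumes "transpose X = X"
  shows "a \<bullet> (X *v b) = b \<bullet> (X *v a)"
  by (metis assms dot_lmul_matrix inner_commute transpose_matrix_vector)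

lemma quadratic_form_conjugate:
  fixes A :: "real^'n^'m" and X :: "real^'n^'n"
  shows "x \<bullet> ((A ** X ** transpose A) *v x) = (x v* A) \<bullet> (X *v (x v* A))"
  by (simp add: matrix_vector_mul_assoc[symmetric] dot_lmul_matrix)

lemma transpose_add: "transpose (X + Y) = transpose X + transpose (Y :: real^'n^'m)"
  by (simp add: transpose_def vec_eq_iff)

lemma transpose_diff: "transpose (X - Y) = transpose X - transpose (Y :: real^'n^'m)"
  by (simp add: transpose_def vec_eq_iff)

lemma matrix_inv_inverse:
  fixes W :: "real^'n^'n"
  assumes "invertible W"
  shows "W ** matrix_inv W = mat 1" "matrix_inv W ** W = mat 1"
  using someI_ex[OF assms[unfolded invertible_def]] by (auto simp: matrix_inv_def)

lemma pd_mats_invertible: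
  fixes W :: "real^'n^'n"
  assumes "W \<in> pd_mats"
  shows "invertible W"
proof -
  have "x = 0" if "W *v x = 0" for x
    using assms that by (force simp: pd_mats_def)
  then show ?thesis
    by (simp add: invertible_left_inverse matrix_left_invertible_ker)
qed

section \<open>The Riccati map as a minimum of quadratic forms\<close>

lemma innovation_covariance_pd:
  fixes C :: "real^'n^'m" and X :: "real^'n^'n"
  assumes "X \<in> psd_mats" "R \<in> pd_mats"
  shows "C ** X ** transpose C + R \<in> pd_mats"
proof -
  have "x \<bullet> ((C ** X ** transpose C + R) *v x) > 0" if "x \<noteq> 0" for x
    using assms that
    by (auto simp: matrix_vector_mult_add_rdistrib inner_add_right quadratic_form_conjugate
        psd_mats_def pd_mats_def intro!: add_nonneg_pos)
  moreover have "transpose (C ** X ** transpose C + R) = C ** X ** transpose C + R"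
    using assms
    by (simp add: transpose_add matrix_transpose_mul matrix_mul_assoc psd_mats_def pd_mats_def)
  ultimately show ?thesis
    by (simp add: pd_mats_def)
qed

text \<open>As a function of the input \<open>u\<close>, the sum of the three cost terms is
  quadratic with the innovation covariance as its matrix. Its minimiser is the optimal gain applied
  to \<open>x\<close>, and the Riccati form is the minimum. Keeping the residual square serves
  twice: dropping it gives an upper bound for every \<open>u\<close>, and putting
  \<open>u = w\<close> gives positivity.\<close>

lemma riccati1_complete_square:
  fixes A Q X :: "real^'n^'n" and C :: "real^'n^'m" and R :: "real^'m^'m"
  assumes "X \<in> psd_mats" "R \<in> pd_mats"
  obtains w where
    "\<And>u. x \<bullet> (riccati1 A C Q R X *v x) =
       (x v* A - u v* C) \<bullet> (X *v (x v* A - u v* C)) + x \<bullet> (Q *v x) + u \<bullet> (R *v u)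
         - (u - w) \<bullet> ((C ** X ** transpose C + R) *v (u - w))"
proof -
  define W where "W = C ** X ** transpose C + R"
  define b where "b = C *v (X *v (x v* A))"
  define w where "w = matrix_inv W *v b"
  have W: "W \<in> pd_mats"
    using innovation_covariance_pd[OF assms] by (simp add: W_def)
  have symW: "transpose W = W" and symX: "transpose X = X"
    using W assms by (auto simp: pd_mats_def psd_mats_def)
  have "W ** matrix_inv W = mat 1"
    using pd_mats_invertible[OF W] by (rule matrix_inv_inverse)
  then have Ww: "W *v w = b"
    by (simp add: w_def matrix_vector_mul_assoc)
  have cross: "(x v* A) \<bullet> (X *v (u v* C)) = u \<bullet> b" for u
    by (metis b_def dot_lmul_matrix symX symmetric_bilinear_commute)
  \<comment> \<open>Reading \<open>cross\<close> backwards at \<open>w\<close> hides the inverse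
    inside \<open>w\<close>, so the term subtracted in the Riccati map matches without transposing
    that inverse.\<close>
  have gain: "x \<bullet> ((A ** X ** transpose C ** matrix_inv W ** C ** X ** transpose A) *v x) = w \<bullet> b"
    unfolding cross[of w, symmetric] unfolding w_def b_def
    by (simp add: matrix_vector_mul_assoc[symmetric] dot_lmul_matrix)
  show ?thesis
  proof (rule that)
    fix u
    have WC: "u \<bullet> (W *v u) = (u v* C) \<bullet> (X *v (u v* C)) + u \<bullet> (R *v u)"
      by (simp add: W_def matrix_vector_mult_add_rdistrib inner_add_right quadratic_form_conjugate)
    have "(u - w) \<bullet> (W *v (u - w)) = u \<bullet> (W *v u) - 2 * (u \<bullet> b) + w \<bullet> b"
      using symmetric_bilinear_commute[OF symW, of w u]
      by (simp add: matrix_vector_mult_diff_distrib inner_diff_left inner_diff_right Ww)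
    moreover have "(x v* A - u v* C) \<bullet> (X *v (x v* A - u v* C)) =
        (x v* A) \<bullet> (X *v (x v* A)) - 2 * (u \<bullet> b) + (u v* C) \<bullet> (X *v (u v* C))"
      using symmetric_bilinear_commute[OF symX, of "x v* A" "u v* C"]
      by (simp add: matrix_vector_mult_diff_distrib inner_diff_left inner_diff_right cross)
    moreover have "x \<bullet> (riccati1 A C Q R X *v x) =
        (x v* A) \<bullet> (X *v (x v* A)) + x \<bullet> (Q *v x) - w \<bullet> b"
      unfolding riccati1_def W_def[symmetric] matrix_vector_mult_diff_rdistrib
        matrix_vector_mult_add_rdistrib inner_add_right inner_diff_right
        quadratic_form_conjugate gain ..
    ultimately show "x \<bullet> (riccati1 A C Q R X *v x) =
       (x v* A - u v* C) \<bullet> (X *v (x v* A - u v* C)) + x \<bullet> (Q *v x) + u \<bullet> (R *v u)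
         - (u - w) \<bullet> ((C ** X ** transpose C + R) *v (u - w))"
      using WC unfolding W_def[symmetric] by simp
  qed
qed

text \<open>A suboptimal input can only raise the cost, since the residual square is nonnegative.
  The freedom in \<open>u\<close> is what permits steering later on.\<close>

lemma riccati1_le:
  fixes A Q X :: "real^'n^'n" and C :: "real^'n^'m" and R :: "real^'m^'m"
  assumes "X \<in> psd_mats" "R \<in> pd_mats"
  shows "x \<bullet> (riccati1 A C Q R X *v x) \<le>
    (x v* A - u v* C) \<bullet> (X *v (x v* A - u v* C)) + x \<bullet> (Q *v x) + u \<bullet> (R *v u)"
proof -
  obtain w where w: "\<And>u. x \<bullet> (riccati1 A C Q R X *v x) =
       (x v* A - u v* C) \<bullet> (X *v (x v* A - u v* C)) + x \<bullet> (Q *v x) + u \<bullet> (R *v u)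
         - (u - w) \<bullet> ((C ** X ** transpose C + R) *v (u - w))"
    using riccati1_complete_square[OF assms] by blast
  have "(u - w) \<bullet> ((C ** X ** transpose C + R) *v (u - w)) \<ge> 0"
    using innovation_covariance_pd[OF assms, of C] unfolding pd_mats_def
    by (cases "u = w") (auto intro: less_imp_le)
  then show ?thesis
    by (subst w[of u]) simp
qed

lemma riccati1_psd:
  fixes A Q X :: "real^'n^'n" and C :: "real^'n^'m" and R :: "real^'m^'m"
  assumes "X \<in> psd_mats" "Q \<in> psd_mats" "R \<in> pd_mats"
  shows "riccati1 A C Q R X \<in> psd_mats"
proof -
  define V where "V = matrix_inv (C ** X ** transpose C + R)"
  have W: "C ** X ** transpose C + R \<in> pd_mats"
    by (rule innovation_covariance_pd[OF assms(1,3)])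
  have "V ** (C ** X ** transpose C + R) = mat 1" "(C ** X ** transpose C + R) ** V = mat 1"
    using pd_mats_invertible[OF W] by (simp_all add: V_def matrix_inv_inverse)
  \<comment> \<open>The transpose of \<open>V\<close> also inverts the symmetric innovation
    covariance, and inverses are unique.\<close>
  then have "transpose V = V"
    using W unfolding pd_mats_def mem_Collect_eq
    by (metis matrix_mul_assoc matrix_mul_lid matrix_mul_rid matrix_transpose_mul transpose_mat)
  then have "transpose (riccati1 A C Q R X) = riccati1 A C Q R X"
    using assms unfolding riccati1_def V_def[symmetric]
    by (simp add: transpose_add transpose_diff matrix_transpose_mul matrix_mul_assoc psd_mats_def)
  moreover have "x \<bullet> (riccati1 A C Q R X *v x) \<ge> 0" for x
  proof -
    obtain w where w: "\<And>u. x \<bullet> (riccati1 A C Q R X *v x) =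
       (x v* A - u v* C) \<bullet> (X *v (x v* A - u v* C)) + x \<bullet> (Q *v x) + u \<bullet> (R *v u)
         - (u - w) \<bullet> ((C ** X ** transpose C + R) *v (u - w))"
      using riccati1_complete_square[OF assms(1,3)] by blast
    have "w \<bullet> (R *v w) \<ge> 0"
      using assms(3) by (cases "w = 0") (auto simp: pd_mats_def intro: less_imp_le)
    \<comment> \<open>At the minimiser \<open>u = w\<close> the residual vanishes and only
      nonnegative terms are left.\<close>
    then show ?thesis
      using assms(1,2) by (subst w[of w]) (simp add: psd_mats_def)
  qed
  ultimately show ?thesis
    by (simp add: psd_mats_def)
qed

lemma riccati1_funpow_psd:
  fixes A Q X :: "real^'n^'n" and C :: "real^'n^'m" and R :: "real^'m^'m"
  assumes "X \<in> psd_mats" "Q \<in> psd_mats" "R \<in> pd_mats"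
  shows "(riccati1 A C Q R ^^ n) X \<in> psd_mats"
  using assms by (induction n) (auto intro: riccati1_psd)

lemma riccati0_psd:
  fixes A Q X :: "real^'n^'n"
  assumes "X \<in> psd_mats" "Q \<in> psd_mats"
  shows "riccati0 A Q X \<in> psd_mats"
  using assms
  by (auto simp: riccati0_def psd_mats_def transpose_add matrix_transpose_mul matrix_mul_assoc
      matrix_vector_mult_add_rdistrib inner_add_right quadratic_form_conjugate)

lemma riccati_seq_psd:
  fixes A Q P0 :: "real^'n^'n" and C :: "real^'n^'m" and R :: "real^'m^'m"
  assumes "P0 \<in> psd_mats" "Q \<in> psd_mats" "R \<in> pd_mats"
  shows "riccati_seq A C Q R P0 \<gamma> t \<in> psd_mats"
  using assms by (induction t) (auto intro: riccati0_psd riccati1_psd)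

section \<open>Steering the dual system to zero\<close>

lemma observability_rows_funpow:
  fixes A :: "real^'n^'n" and C :: "real^'n^'m"
  shows "u v* (((\<lambda>X. X ** A) ^^ n) C) = ((\<lambda>v. v v* A) ^^ n) (u v* C)"
  by (induction n) (simp_all add: vector_matrix_mul_assoc[symmetric])

lemma linear_funpow_vector_matrix:
  fixes A :: "real^'n^'n"
  shows "linear ((\<lambda>v. v v* A) ^^ n)"
proof (induction n)
  case 0
  then show ?case by (simp add: linear_id[unfolded id_def] id_def)
next
  case (Suc n)
  have "linear (\<lambda>v. v v* A)"
    by (metis (no_types, lifting) ext matrix_vector_mul_linear transpose_matrix_vector)
  with Suc show ?case
    using linear_compose[of "(\<lambda>v. v v* A) ^^ n" "\<lambda>v. v v* A"] by (simp add: o_def)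
qed

lemma span_rows_imp_vector_matrix:
  fixes M :: "real^'n^'m"
  assumes "r \<in> span (rows M)"
  obtains u where "r = u v* M"
proof -
  have "subspace (range (\<lambda>u. u v* M))"
    by (metis (no_types, lifting) ext linear_subspace_image matrix_vector_mul_linear
        subspace_UNIV transpose_matrix_vector)
  moreover have "rows M \<subseteq> range (\<lambda>u. u v* M)"
  proof -
    have "row i M = axis i 1 v* M" for i
      by (simp add: row_def vector_matrix_mult_def vec_eq_iff axis_def if_distrib if_distribR cong: if_cong)
    then show ?thesis
      by (auto simp: rows_def)
  qed
  ultimately have "span (rows M) \<subseteq> range (\<lambda>u. u v* M)"
    by (rule span_minimal[rotated])
  with assms that show ?thesis
    by blast
qed

text \<open>The span condition says that inputs can cancel the free motion of \<open>x\<close> in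
  \<open>n\<close> steps of the dual system. The terminal cost, the only place where
  \<open>X\<close> enters, is then zero, and \<open>c\<close> is the running cost in
  \<open>Q\<close> and \<open>R\<close>. Stating this for arbitrary \<open>n\<close> and
  \<open>x\<close>, rather than only for a full span, is what makes the induction possible.\<close>

lemma riccati1_funpow_quadratic_bound:
  fixes A Q :: "real^'n^'n" and C :: "real^'n^'m" and R :: "real^'m^'m"
  assumes "Q \<in> psd_mats" "R \<in> pd_mats"
    and "((\<lambda>v. v v* A) ^^ n) x \<in> span (\<Union>k<n. rows (((\<lambda>X. X ** A) ^^ k) C))"
  shows "\<exists>c. \<forall>X \<in> psd_mats. x \<bullet> ((riccati1 A C Q R ^^ n) X *v x) \<le> c"
  using assms(3)
proof (induction n arbitrary: x)
  case 0
  \<comment> \<open>With no steps left the span is that of the empty set: the state has reached zero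
    and \<open>X\<close> drops out.\<close>
  then have "x = 0" by simp
  then show ?case by auto
next
  case (Suc n)
  let ?S = "\<Union>k<n. rows (((\<lambda>X. X ** A) ^^ k) C)"
  \<comment> \<open>The input of the current step still passes through \<open>n\<close> further
    steps, so it acts through the block with index \<open>n\<close>. It is chosen to cancel the
    component \<open>r\<close> in that block.\<close>
  have "((\<lambda>v. v v* A) ^^ Suc n) x \<in> span (?S \<union> rows (((\<lambda>X. X ** A) ^^ n) C))"
    using Suc.prems by (simp add: lessThan_Suc Un_commute)
  then obtain s r where s: "s \<in> span ?S" and r: "r \<in> span (rows (((\<lambda>X. X ** A) ^^ n) C))"
    and eq: "((\<lambda>v. v v* A) ^^ Suc n) x = s + r"
    unfolding span_Un by blast
  obtain u where "r = ((\<lambda>v. v v* A) ^^ n) (u v* C)"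
    using span_rows_imp_vector_matrix[OF r] observability_rows_funpow by metis
  \<comment> \<open>By linearity the contribution \<open>r\<close> of \<open>u\<close> is subtracted
    from \<open>s + r\<close>, so the next state meets the span condition for
    \<open>n\<close>.\<close>
  with eq have "((\<lambda>v. v v* A) ^^ n) (x v* A - u v* C) = s"
    by (simp add: linear_diff[OF linear_funpow_vector_matrix] funpow_swap1[where f = "\<lambda>v. v v* A", symmetric])
  with Suc.IH s obtain c where c: "\<forall>X \<in> psd_mats.
      (x v* A - u v* C) \<bullet> ((riccati1 A C Q R ^^ n) X *v (x v* A - u v* C)) \<le> c"
    by blast
  have "x \<bullet> ((riccati1 A C Q R ^^ Suc n) X *v x) \<le> c + x \<bullet> (Q *v x) + u \<bullet> (R *v u)"
    if "X \<in> psd_mats" for X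
  proof -
    have "(riccati1 A C Q R ^^ n) X \<in> psd_mats"
      using that assms by (intro riccati1_funpow_psd)
    from riccati1_le[OF this assms(2), of x A C Q u] show ?thesis
      using c that by fastforce
  qed
  then show ?case by blast
qed

section \<open>Norm bounds for a burst of arrivals and for a single step\<close>

lemma spectral_norm_le_diagonal:
  fixes X :: "real^'n^'n"
  assumes "X \<in> psd_mats" and "\<And>i. axis i 1 \<bullet> (X *v axis i 1) \<le> c"
  shows "spectral_norm X \<le> (real CARD('n))\<^sup>2 * c"
proof -
  have entry: "axis i 1 \<bullet> (X *v axis j 1) = X $ i $ j" for i j
    by (simp add: inner_axis' matrix_vector_mult_basis column_def)
  have "\<bar>X $ i $ j\<bar> \<le> c" for i j
  proof -
    have sym: "X $ j $ i = X $ i $ j"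
      using symmetric_bilinear_commute[of X "axis i 1" "axis j 1"] assms(1)
      by (simp add: entry psd_mats_def)
    \<comment> \<open>Testing semidefiniteness on the sum and the difference of two basis vectors
      bounds each entry by the mean of two diagonal entries. The crude factor
      \<open>N\<^sup>2\<close> comes from passing from entries to the operator norm.\<close>
    have "(axis i 1 + axis j 1) \<bullet> (X *v (axis i 1 + axis j 1)) \<ge> 0"
      and "(axis i 1 - axis j 1) \<bullet> (X *v (axis i 1 - axis j 1)) \<ge> 0"
      using assms(1) by (simp_all add: psd_mats_def)
    then have "X $ i $ i + X $ j $ j + 2 * X $ i $ j \<ge> 0"
      and "X $ i $ i + X $ j $ j - 2 * X $ i $ j \<ge> 0"
      by (simp_all add: entry sym matrix_vector_mult_diff_distrib matrix_vector_right_distrib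
          inner_diff_left inner_diff_right inner_add_left inner_add_right)
    moreover have "X $ i $ i \<le> c" "X $ j $ j \<le> c"
      using assms(2)[of i] assms(2)[of j] by (simp_all add: entry)
    ultimately show ?thesis by linarith
  qed
  then show ?thesis
    using onorm_le_matrix_component[of X c] by (simp add: spectral_norm_def power2_eq_square)
qed

lemma quadratic_form_le_spectral_norm:
  fixes X :: "real^'n^'n"
  shows "x \<bullet> (X *v x) \<le> spectral_norm X * (norm x)\<^sup>2"
proof -
  have "x \<bullet> (X *v x) \<le> norm x * norm (X *v x)"
    by (rule norm_cauchy_schwarz)
  also have "\<dots> \<le> norm x * (spectral_norm X * norm x)"
    unfolding spectral_norm_def by (intro mult_left_mono onorm) auto
  finally show ?thesis
    by (simp add: power2_eq_square mult_ac)
qed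

lemma spectral_norm_nonneg: "spectral_norm (X :: real^'n^'m) \<ge> 0"
  unfolding spectral_norm_def by (rule onorm_pos_le) simp

text \<open>Observability makes the span condition hold for every vector. Applying the quadratic
  bound to the finitely many basis vectors controls the diagonal, hence the norm, uniformly in the
  starting matrix.\<close>

lemma riccati1_burst_bound:
  fixes A Q :: "real^'n^'n" and C :: "real^'n^'m" and R :: "real^'m^'m"
  assumes Q: "Q \<in> psd_mats" and R: "R \<in> pd_mats" and "observable C A"
  obtains c where
    "\<And>X. X \<in> psd_mats \<Longrightarrow> spectral_norm ((riccati1 A C Q R ^^ CARD('n)) X) \<le> c"
proof -
  let ?S = "\<Union>k<CARD('n). rows (((\<lambda>X. X ** A) ^^ k) C)"
  have "span ?S = UNIV"
    using assms(3) by (subst dim_eq_full[symmetric]) (simp add: observable_def)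
  then have "\<exists>c. \<forall>X \<in> psd_mats. x \<bullet> ((riccati1 A C Q R ^^ CARD('n)) X *v x) \<le> c" for x
    by (intro riccati1_funpow_quadratic_bound[OF Q R]) auto
  then have "\<exists>c. \<forall>i. \<forall>X \<in> psd_mats.
      axis i 1 \<bullet> ((riccati1 A C Q R ^^ CARD('n)) X *v axis i 1) \<le> c i"
    by (intro choice) blast
  then obtain c where c: "\<And>i X. X \<in> psd_mats \<Longrightarrow>
      axis i 1 \<bullet> ((riccati1 A C Q R ^^ CARD('n)) X *v axis i 1) \<le> c i"
    by blast
  have "spectral_norm ((riccati1 A C Q R ^^ CARD('n)) X) \<le> (real CARD('n))\<^sup>2 * Max (range c)"
    if "X \<in> psd_mats" for X
  proof (rule spectral_norm_le_diagonal)
    show "(riccati1 A C Q R ^^ CARD('n)) X \<in> psd_mats"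
      using that Q R by (intro riccati1_funpow_psd)
    show "axis i 1 \<bullet> ((riccati1 A C Q R ^^ CARD('n)) X *v axis i 1) \<le> Max (range c)" for i
      using c[OF that, of i] by (rule order_trans) simp
  qed
  then show ?thesis
    by (rule that)
qed

text \<open>Only monotonicity and \<open>k \<le> h k\<close> matter later: they let iterates of
  \<open>h\<close> be compared and padded with extra steps.\<close>

lemma riccati_step_growth:
  fixes A Q :: "real^'n^'n" and C :: "real^'n^'m" and R :: "real^'m^'m"
  assumes Q: "Q \<in> psd_mats" and R: "R \<in> pd_mats"
  obtains h :: "real \<Rightarrow> real" where "mono h" and "\<And>k. k \<ge> 0 \<Longrightarrow> k \<le> h k"
    and "\<And>P0 \<gamma> t. P0 \<in> psd_mats \<Longrightarrow> spectral_norm (riccati_seq A C Q R P0 \<gamma> (Suc t))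
       \<le> h (spectral_norm (riccati_seq A C Q R P0 \<gamma> t))"
proof -
  define a where "a = (Max (range (\<lambda>i. norm (axis i 1 v* A))))\<^sup>2"
  define q where "q = spectral_norm Q"
  \<comment> \<open>The summand \<open>k\<close> secures \<open>k \<le> h k\<close> even when the
    affine bound alone would shrink \<open>k\<close>.\<close>
  define h where "h k = k + (real CARD('n))\<^sup>2 * (a * k + q)" for k
  have a: "a \<ge> 0" and q: "q \<ge> 0"
    by (simp_all add: a_def q_def spectral_norm_nonneg)
  show ?thesis
  proof
    show "mono h"
      unfolding h_def using a by (intro monoI add_mono mult_left_mono) auto
    show "k \<le> h k" if "k \<ge> 0" for k
      using that a q by (simp add: h_def)
    fix P0 :: "real^'n^'n" and \<gamma> t
    assume P0: "P0 \<in> psd_mats"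
    let ?X = "riccati_seq A C Q R P0 \<gamma> t"
    let ?Y = "riccati_seq A C Q R P0 \<gamma> (Suc t)"
    have X: "?X \<in> psd_mats" and Y: "?Y \<in> psd_mats"
      by (rule riccati_seq_psd[OF P0 Q R])+
    have "spectral_norm ?Y \<le> (real CARD('n))\<^sup>2 * (a * spectral_norm ?X + q)"
    proof (rule spectral_norm_le_diagonal[OF Y])
      fix i
      let ?e = "axis i 1 :: real^'n"
      \<comment> \<open>With \<open>u = 0\<close> the bound for an arrival becomes the exact form
        for a loss, so one estimate covers both cases.\<close>
      have "?e \<bullet> (?Y *v ?e) \<le> (?e v* A) \<bullet> (?X *v (?e v* A)) + ?e \<bullet> (Q *v ?e)"
        using riccati1_le[OF X R, of ?e A C Q 0]
        by (simp add: riccati0_def quadratic_form_conjugate matrix_vector_mult_add_rdistrib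
            inner_add_right)
      also have "\<dots> \<le> spectral_norm ?X * (norm (?e v* A))\<^sup>2 + q"
        using quadratic_form_le_spectral_norm[of ?e Q] quadratic_form_le_spectral_norm[of "?e v* A" ?X]
        by (simp add: q_def)
      also have "\<dots> \<le> spectral_norm ?X * a + q"
        unfolding a_def
        by (intro add_mono mult_left_mono power_mono spectral_norm_nonneg Max_ge) auto
      finally show "?e \<bullet> (?Y *v ?e) \<le> a * spectral_norm ?X + q"
        by (simp add: mult.commute)
    qed
    then show "spectral_norm ?Y \<le> h (spectral_norm ?X)"
      using spectral_norm_nonneg[of ?X] by (simp add: h_def)
  qed
qed

section \<open>Blocks of consecutive arrivals\<close>

lemma prob_space_arrivals: "prob_space (arrivals p)"
  unfolding arrivals_def by (intro prob_space_PiM measure_pmf.prob_space_axioms)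

text \<open>The blocks use disjoint sets of coordinates, so they are independent, and each consists
  of arrivals alone with probability \<open>p ^ n\<close>.\<close>

lemma prob_no_full_block:
  assumes p: "p \<in> {0..1}"
  shows "{\<gamma> \<in> space (arrivals p). \<forall>j<L. \<exists>i<n. \<not> \<gamma> (m + j * n + i)} \<in> sets (arrivals p)"
    and "measure (arrivals p) {\<gamma> \<in> space (arrivals p). \<forall>j<L. \<exists>i<n. \<not> \<gamma> (m + j * n + i)}
      = (1 - p ^ n) ^ L"
proof -
  interpret P: product_prob_space "\<lambda>_::nat. measure_pmf (bernoulli_pmf p)" UNIV
    by unfold_locales
  have arr: "arrivals p = PiM UNIV (\<lambda>_. measure_pmf (bernoulli_pmf p))"
    by (simp add: arrivals_def)
  define K where "K j = {m + j * n..<m + Suc j * n}" for j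
  have block: "(\<exists>i<n. \<not> \<gamma> (m + j * n + i)) \<longleftrightarrow> (\<exists>i\<in>K j. \<not> \<gamma> i)" for \<gamma> j
  proof
    assume "\<exists>i\<in>K j. \<not> \<gamma> i"
    then obtain i where "i \<in> K j" "\<not> \<gamma> i" by blast
    then have "i - (m + j * n) < n" "\<not> \<gamma> (m + j * n + (i - (m + j * n)))"
      by (auto simp: K_def)
    then show "\<exists>i<n. \<not> \<gamma> (m + j * n + i)" by blast
  qed (force simp: K_def)
  \<comment> \<open>The block event is first written on the finite product over \<open>K j\<close>,
    so that independence of the restrictions applies; \<open>F j\<close> is its preimage.\<close>
  define B where "B j = {\<omega> \<in> space (PiM (K j) (\<lambda>_. measure_pmf (bernoulli_pmf p))). \<exists>i\<in>K j. \<not> \<omega> i}" for j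
  have B: "B j \<in> sets (PiM (K j) (\<lambda>_. measure_pmf (bernoulli_pmf p)))" for j
    unfolding B_def
    by (rule sets.sets_Collect_finite_Ex) (auto simp: K_def intro: sets_Collect_single')
  define F where "F j = {\<gamma> \<in> space (arrivals p). \<exists>i\<in>K j. \<not> \<gamma> i}" for j
  have rest: "(\<lambda>\<gamma>. restrict (\<lambda>i. \<gamma> i) (K j)) -` B j \<inter> space (arrivals p) = F j" for j
    by (auto simp: B_def F_def space_PiM arr)
  have F: "F j \<in> sets (arrivals p)" for j
    unfolding rest[symmetric]
    by (rule measurable_sets[OF _ B]) (simp add: arr measurable_restrict_subset)
  have "P.indep_vars (\<lambda>_. measure_pmf (bernoulli_pmf p)) (\<lambda>i \<gamma>. \<gamma> i) UNIV"
    by (subst P.indep_vars_iff_distr_eq_PiM)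
      (simp_all add: P.PiM_component restrict_UNIV)
  then have indep: "P.indep_vars (\<lambda>j. PiM (K j) (\<lambda>_. measure_pmf (bernoulli_pmf p)))
      (\<lambda>j \<gamma>. restrict (\<lambda>i. \<gamma> i) (K j)) {..<L}"
  proof (rule P.indep_vars_restrict)
    show "disjoint_family_on K {..<L}"
      unfolding disjoint_family_on_def
    proof (intro ballI impI)
      fix i j :: nat
      assume "i \<noteq> j"
      then have "Suc i * n \<le> j * n \<or> Suc j * n \<le> i * n"
        by (metis mult_le_mono1 linorder_neqE_nat Suc_leI)
      then show "K i \<inter> K j = {}"
        by (auto simp: K_def)
    qed
  qed simp
  have blockprob: "measure (arrivals p) (F j) = 1 - p ^ n" for j
  proof -
    \<comment> \<open>The complementary event is a finite cylinder, whose measure is a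
      product.\<close>
    have eq: "{\<gamma> \<in> space (arrivals p). \<forall>i\<in>K j. \<gamma> i \<in> {True}} =
        P.emb UNIV (K j) (Pi\<^sub>E (K j) (\<lambda>_. {True}))"
      by (auto simp: prod_emb_def space_PiM arr PiE_iff fun_eq_iff split: if_splits)
    have "measure (arrivals p) {\<gamma> \<in> space (arrivals p). \<forall>i\<in>K j. \<gamma> i \<in> {True}} = p ^ n"
      unfolding eq unfolding arr using p
      by (subst P.measure_PiM_emb) (auto simp: K_def measure_pmf_single)
    moreover have "F j = space (arrivals p) - {\<gamma> \<in> space (arrivals p). \<forall>i\<in>K j. \<gamma> i \<in> {True}}"
      by (auto simp: F_def)
    moreover have "{\<gamma> \<in> space (arrivals p). \<forall>i\<in>K j. \<gamma> i \<in> {True}} \<in> sets (arrivals p)"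
      unfolding eq unfolding arr by (rule sets_PiM_I) (auto simp: K_def)
    ultimately show ?thesis
      using P.prob_compl by (simp add: arr)
  qed
  have set_eq: "{\<gamma> \<in> space (arrivals p). \<forall>j<L. \<exists>i<n. \<not> \<gamma> (m + j * n + i)} =
      {\<gamma> \<in> space (arrivals p). \<forall>j<L. \<gamma> \<in> F j}"
    by (auto simp: block F_def)
  show "{\<gamma> \<in> space (arrivals p). \<forall>j<L. \<exists>i<n. \<not> \<gamma> (m + j * n + i)} \<in> sets (arrivals p)"
    unfolding set_eq using F by measurable
  show "measure (arrivals p) {\<gamma> \<in> space (arrivals p). \<forall>j<L. \<exists>i<n. \<not> \<gamma> (m + j * n + i)}
      = (1 - p ^ n) ^ L"
  \<comment> \<open>The product rule for independent events asks for a nonempty index set.\<close>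
  proof (cases "L = 0")
    case True
    then show ?thesis by (simp add: prob_space.prob_space prob_space_arrivals)
  next
    case False
    have "measure (arrivals p) (\<Inter>j<L. F j) = (\<Prod>j<L. measure (arrivals p) (F j))"
      using P.indep_varsD_finite[OF indep, of B] False B
      unfolding arr[symmetric] rest by (simp add: lessThan_empty_iff)
    moreover have "{\<gamma> \<in> space (arrivals p). \<forall>j<L. \<gamma> \<in> F j} = (\<Inter>j<L. F j)"
      using False by (auto simp: F_def)
    ultimately show ?thesis
      by (simp add: set_eq blockprob)
  qed
qed

section \<open>Tail bound and stochastic boundedness\<close>

lemma riccati_seq_burst:
  assumes "\<And>i. i < n \<Longrightarrow> \<gamma> (s + i)"
  shows "riccati_seq A C Q R P0 \<gamma> (s + n) = (riccati1 A C Q R ^^ n) (riccati_seq A C Q R P0 \<gamma> s)"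
  using assms by (induction n) auto

text \<open>A full block among the last \<open>L\<close> ones resets the norm below a fixed level,
  and only boundedly many growth steps remain. The threshold depends on \<open>L\<close> but not on
  \<open>t\<close>.\<close>

lemma riccati_seq_tail_bound:
  fixes A Q P0 :: "real^'n^'n" and C :: "real^'n^'m" and R :: "real^'m^'m"
  assumes Q: "Q \<in> psd_mats" and R: "R \<in> pd_mats" and obs: "observable C A"
    and p: "p \<in> {0..1}" and P0: "P0 \<in> psd_mats"
  shows "\<exists>K0. \<forall>K\<ge>K0. \<forall>t. measure (arrivals p)
      {\<gamma> \<in> space (arrivals p). spectral_norm (riccati_seq A C Q R P0 \<gamma> t) > K} \<le> (1 - p ^ CARD('n)) ^ L"
proof -
  let ?P = "riccati_seq A C Q R P0"
  let ?n = "CARD('n)"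
  obtain c where c: "\<And>X. X \<in> psd_mats \<Longrightarrow> spectral_norm ((riccati1 A C Q R ^^ ?n) X) \<le> c"
    using riccati1_burst_bound[OF Q R obs] by blast
  obtain h where h: "mono h" "\<And>k. k \<ge> 0 \<Longrightarrow> k \<le> h k"
    and step: "\<And>P0 \<gamma> t. P0 \<in> psd_mats \<Longrightarrow> spectral_norm (riccati_seq A C Q R P0 \<gamma> (Suc t))
       \<le> h (spectral_norm (riccati_seq A C Q R P0 \<gamma> t))"
    using riccati_step_growth[OF Q R, where A = A and C = C] by blast
  \<comment> \<open>One level covers both restart points, the initial state and the end of a full
    block.\<close>
  define k where "k = max c (spectral_norm P0)"
  have k: "k \<ge> 0"
    using spectral_norm_nonneg[of P0] by (simp add: k_def)
  have above: "k \<le> (h ^^ d) k" for d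
  proof (induction d)
    case (Suc d)
    moreover have "(h ^^ d) k \<le> h ((h ^^ d) k)"
      using Suc k by (intro h) simp
    ultimately show ?case by simp
  qed simp
  \<comment> \<open>The slack \<open>e\<close> raises the number of iterations to a common value,
    whatever the distance from the restart.\<close>
  have grow: "spectral_norm (?P \<gamma> (s + d)) \<le> (h ^^ (d + e)) k"
    if "spectral_norm (?P \<gamma> s) \<le> k" for \<gamma> s d e
  proof (induction d)
    case 0
    with that above[of e] show ?case by simp
  next
    case (Suc d)
    have "spectral_norm (?P \<gamma> (s + Suc d)) \<le> h (spectral_norm (?P \<gamma> (s + d)))"
      using step[OF P0, of \<gamma> "s + d"] by simp
    also have "\<dots> \<le> h ((h ^^ (d + e)) k)"
      using h(1) Suc by (rule monoD)
    finally show ?case by simp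
  qed
  have "measure (arrivals p) {\<gamma> \<in> space (arrivals p). spectral_norm (?P \<gamma> t) > K} \<le> (1 - p ^ ?n) ^ L"
    if K: "K \<ge> (h ^^ (L * ?n)) k" for K t
  proof (cases "t < L * ?n")
    \<comment> \<open>Too early for \<open>L\<close> blocks to fit, but then fewer than
      \<open>L * ?n\<close> steps separate \<open>t\<close> from the initial state, and the event is
      empty.\<close>
    case True
    have "spectral_norm (?P \<gamma> t) \<le> K" for \<gamma>
      using grow[of \<gamma> 0 t "L * ?n - t"] True K by (simp add: k_def)
    then have empty: "{\<gamma> \<in> space (arrivals p). spectral_norm (?P \<gamma> t) > K} = {}"
      by (auto simp: not_less)
    have "p ^ ?n \<le> 1"
      using p by (simp add: power_le_one)
    then show ?thesis
      unfolding empty by simp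
  next
    case False
    \<comment> \<open>The \<open>L\<close> blocks starting at \<open>?m\<close> tile the window that
      ends just before \<open>t\<close>.\<close>
    let ?m = "t - L * ?n"
    have "\<exists>i<?n. \<not> \<gamma> (?m + j * ?n + i)"
      if big: "spectral_norm (?P \<gamma> t) > K" and j: "j < L" for \<gamma> j
    proof (rule ccontr)
      assume "\<not> (\<exists>i<?n. \<not> \<gamma> (?m + j * ?n + i))"
      then have "?P \<gamma> (?m + j * ?n + ?n) = (riccati1 A C Q R ^^ ?n) (?P \<gamma> (?m + j * ?n))"
        by (intro riccati_seq_burst) blast
      then have "spectral_norm (?P \<gamma> (?m + j * ?n + ?n)) \<le> k"
        using c[OF riccati_seq_psd[OF P0 Q R]] by (simp add: k_def le_max_iff_disj)
      \<comment> \<open>The steps left after block \<open>j\<close> are padded with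
        \<open>e = Suc j * ?n\<close> to \<open>L * ?n\<close> iterations.\<close>
      then have "spectral_norm (?P \<gamma> (?m + j * ?n + ?n + (L * ?n - Suc j * ?n)))
          \<le> (h ^^ (L * ?n - Suc j * ?n + Suc j * ?n)) k"
        by (rule grow)
      moreover have le: "Suc j * ?n \<le> L * ?n"
        using j by (intro mult_le_mono1) simp
      moreover have "?m + j * ?n + ?n + (L * ?n - Suc j * ?n) = t"
        using le False by simp
      ultimately have "spectral_norm (?P \<gamma> t) \<le> (h ^^ (L * ?n)) k"
        by (simp only: le_add_diff_inverse2)
      with big K show False by simp
    qed
    then have "{\<gamma> \<in> space (arrivals p). spectral_norm (?P \<gamma> t) > K}
        \<subseteq> {\<gamma> \<in> space (arrivals p). \<forall>j<L. \<exists>i<?n. \<not> \<gamma> (?m + j * ?n + i)}"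
      by auto
    from finite_measure.finite_measure_mono[OF prob_space.finite_measure[OF prob_space_arrivals]
        this prob_no_full_block(1)[OF p]]
    show ?thesis
      unfolding prob_no_full_block(2)[OF p] .
  qed
  then show ?thesis by blast
qed

lemma riccati_seq_stochastically_bounded:
  fixes A Q P0 :: "real^'n^'n" and C :: "real^'n^'m" and R :: "real^'m^'m"
  assumes "Q \<in> psd_mats" "R \<in> pd_mats" "observable C A" "p \<in> {0<..1}" "P0 \<in> psd_mats"
  shows "stochastically_bounded (arrivals p) (\<lambda>t \<gamma>. riccati_seq A C Q R P0 \<gamma> t)"
  unfolding stochastically_bounded_def
proof (rule tendstoI)
  fix e :: real
  assume "e > 0"
  let ?q = "1 - p ^ CARD('n)"
  let ?f = "\<lambda>K t. measure (arrivals p)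
      {\<gamma> \<in> space (arrivals p). spectral_norm (riccati_seq A C Q R P0 \<gamma> t) > K}"
  \<comment> \<open>Positivity of \<open>p\<close> enters here: enough blocks make the failure
    probability smaller than \<open>e\<close>.\<close>
  have "?q < 1"
    using assms(4) by simp
  with \<open>e > 0\<close> obtain L where L: "?q ^ L < e"
    using real_arch_pow_inv by blast
  have p: "p \<in> {0..1}"
    using assms(4) by simp
  obtain K0 where K0: "\<And>K t. K \<ge> K0 \<Longrightarrow> ?f K t \<le> ?q ^ L"
    using riccati_seq_tail_bound[OF assms(1-3) p assms(5), of L] by blast
  have "dist (SUP t. ?f K t) 0 < e" if "K \<ge> K0" for K
  proof -
    have "(SUP t. ?f K t) \<le> ?q ^ L"
      using K0[OF that] by (intro cSUP_least) auto
    \<comment> \<open>A supremum of reals dominates its members only for a family bounded above; the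
      tail bound supplies this.\<close>
    moreover have "(SUP t. ?f K t) \<ge> 0"
      using K0[OF that] by (intro cSUP_upper2[where x = 0] bdd_aboveI2[where M = "?q ^ L"]) auto
    ultimately show ?thesis
      using L by simp
  qed
  then show "\<forall>\<^sub>F K in at_top. dist (SUP t. ?f K t) 0 < e"
    by (rule eventually_mono[OF eventually_ge_at_top])
qed

theorem mainTheorem2:
  fixes A Q :: "real^'n^'n" and C :: "real^'n^'m" and R :: "real^'m^'m"
  assumes "Q \<in> psd_mats" and "R \<in> pd_mats"
    and "controllable A (psd_sqrt Q)" and "observable C A"
  shows "gamma_sb A C Q R = 0 \<and>
         (\<forall>p \<in> {0<..1}. \<forall>P0 \<in> psd_mats.
            ((\<lambda>K. SUP t. measure (arrivals p)
                     {\<gamma> \<in> space (arrivals p). spectral_norm (riccati_seq A C Q R P0 \<gamma> t) > K})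
              \<longlongrightarrow> 0) at_top)"
proof
  let ?S = "{p \<in> {0..1::real}. \<forall>P0 \<in> psd_mats.
            stochastically_bounded (arrivals p) (\<lambda>t \<gamma>. riccati_seq A C Q R P0 \<gamma> t)}"
  have S: "p \<in> ?S" if "p \<in> {0<..1}" for p
    using that riccati_seq_stochastically_bounded[OF assms(1,2,4)] by auto
  have "Inf ?S \<le> e" if "e > 0" for e
  proof -
    \<comment> \<open>Capping at 1 keeps the witness inside the interval where boundedness is
      known.\<close>
    have "Inf ?S \<le> min e 1"
      using that by (intro cInf_lower S bdd_belowI[where m = 0]) auto
    then show ?thesis by simp
  qed
  then have "Inf ?S \<le> 0"
    by (rule field_le_epsilon[of _ 0, simplified])
  moreover have "Inf ?S \<ge> 0"
    \<comment> \<open>The member 1 shows that the set is nonempty, as the lower bound on its infimum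
      requires.\<close>
    using S[of 1] by (intro cInf_greatest) auto
  ultimately show "gamma_sb A C Q R = 0"
    by (simp add: gamma_sb_def)
  show "\<forall>p \<in> {0<..1}. \<forall>P0 \<in> psd_mats.
            ((\<lambda>K. SUP t. measure (arrivals p)
                     {\<gamma> \<in> space (arrivals p). spectral_norm (riccati_seq A C Q R P0 \<gamma> t) > K})
              \<longlongrightarrow> 0) at_top"
    using riccati_seq_stochastically_bounded[OF assms(1,2,4)]
    unfolding stochastically_bounded_def by blast
qed

end
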